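(* Let $n\ge2$ and let $\mathbf X=(X_1,\dots,X_n)$ be a vector of independent (not necessarily identically distributed) random variables with values in $[0,1]$. Then for $\delta>0$ we have, writing $\mathbb EV_n$ for $\mathbb E_{\mathbf X}V_n(\mathbf X)$, $$\Pr\left\{\sqrt{\mathbb EV_n}>\sqrt{V_n(\mathbf X)}+\sqrt{\frac{2\ln(1/\delta)}{n-1}}\right\}\le\delta$$ and $$\Pr\left\{\sqrt{V_n(\mathbf X)}>\sqrt{\mathbb EV_n}+\sqrt{\frac{2\ln(1/\delta)}{n-1}}\right\}\le\delta .$$
   Context: For $\mathbf x=(x_1,\dots,x_n)\in[0,1]^n$, $V_n(\mathbf x)=\frac{1}{n(n-1)}\sum_{i,j=1}^n\frac{(x_i-x_j)^2}{2}$ is the sample variance. For $\delta\ge1$ the assertions are vacuous. *)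

theory Defs
  imports "HOL-Probability.Probability"
begin

definition sample_variance :: "nat \<Rightarrow> (nat \<Rightarrow> real) \<Rightarrow> real" where
  "sample_variance n x =
     1 / (real n * (real n - 1)) * (\<Sum>i=1..n. \<Sum>j=1..n. (x i - x j)\<^sup>2 / 2)"

end

theory Submission
  imports Defs
begin

text \<open>
  Up to the factor \<open>n - 1\<close>, the sample variance is \<open>W(x) = min\<^sub>c \<Sum>\<^sub>i (x\<^sub>i - c)\<^sup>2\<close>. The
  inf-convolution of \<open>t W / 2\<close> with half the squared Euclidean distance is \<open>t / (1 + t) W / 2\<close>, so
  dual weak-transport inequalities for product measures on the cube give
  \<open>E exp (- t W / 2) \<le> exp (- t / (1 + t) E W / 2)\<close> and
  \<open>E exp (t / (1 + t) W / 2) \<le> exp (t E W / 2)\<close>.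
  Optimising the Chernoff bounds over \<open>t\<close> yields \<open>exp (- (sqrt w - sqrt (E W))\<^sup>2 / 2)\<close> for both tails.

  The transport inequalities tensorise: replacing one coordinate at a time by its
  inf-convolution, each step is a one-dimensional inequality, which follows from
  \<open>exp (- s) \<le> 1 - s + s\<^sup>2 / 2\<close> and \<open>exp (s - s\<^sup>2 / 2) \<le> 1 + s\<close>. In the weighted form
  \<open>min\<^sub>c \<Sum>\<^sub>i w\<^sub>i (x\<^sub>i - c)\<^sup>2\<close>, convolving in coordinate \<open>k\<close> just replaces \<open>w\<^sub>k\<close> by \<open>w\<^sub>k / (1 + w\<^sub>k)\<close>.
\<close>

section \<open>One-dimensional inequalities\<close>

text \<open>The choice \<open>p = min t 1\<close> minimises
  \<open>(1 - p) * t + p\<^sup>2 / 2\<close> over \<open>p\<close> in \<open>[0, 1]\<close>. For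
  \<open>t \<le> 1\<close> the minimum is \<open>t - t\<^sup>2 / 2\<close>, and a sign check of the
  derivative suffices; beyond, it is \<open>1/2\<close>, and \<open>exp (- t) \<le> 1/2\<close> is
  enough.\<close>

lemma exp_neg_truncated_quadratic_le:
  fixes t :: real
  assumes "0 \<le> t"
  defines "p \<equiv> min t 1"
  shows "exp (- t) + (1 - p) * t + p\<^sup>2 / 2 \<le> 1"
proof (cases "t \<le> 1")
  case True
  have "(\<lambda>s. exp (- s) + (1 - s) * s + s\<^sup>2 / 2) t \<le> (\<lambda>s. exp (- s) + (1 - s) * s + s\<^sup>2 / 2) 0"
  proof (rule DERIV_nonpos_imp_nonincreasing[OF assms(1)], intro exI conjI)
    fix s :: real assume "0 \<le> s" "s \<le> t"
    show "((\<lambda>s. exp (- s) + (1 - s) * s + s\<^sup>2 / 2) has_real_derivative (- exp (- s) + 1 - s)) (at s)"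
      by (auto intro!: derivative_eq_intros simp: algebra_simps)
    show "- exp (- s) + 1 - s \<le> 0"
      using exp_ge_add_one_self[of "-s"] by simp
  qed
  then show ?thesis using True by (simp add: p_def)
next
  case False
  have "2 \<le> exp (1::real)" using exp_ge_add_one_self[of "1::real"] by simp
  also have "\<dots> \<le> exp t" using False by simp
  finally have "exp (-t) \<le> 1/2" by (simp add: exp_minus field_simps)
  then show ?thesis using False by (simp add: p_def)
qed

text \<open>The same minimiser \<open>p\<close>. For \<open>t \<le> 1\<close> this is
  \<open>t - t\<^sup>2 / 2 \<le> ln (1 + t)\<close>; for larger \<open>t\<close> the exponent is the
  constant \<open>1/2\<close>.\<close>

lemma exp_truncated_quadratic_le:
  fixes t :: real
  assumes "0 \<le> t"
  defines "p \<equiv> min t 1"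
  shows "exp ((1 - p) * t + p\<^sup>2 / 2) \<le> 1 + t"
proof (cases "t \<le> 1")
  case True
  have "(\<lambda>s. ln (1 + s) - (1 - s) * s - s\<^sup>2 / 2) 0 \<le> (\<lambda>s. ln (1 + s) - (1 - s) * s - s\<^sup>2 / 2) t"
  proof (rule DERIV_nonneg_imp_nondecreasing[OF assms(1)], intro exI conjI)
    fix s :: real assume s: "0 \<le> s" "s \<le> t"
    show "((\<lambda>s. ln (1 + s) - (1 - s) * s - s\<^sup>2 / 2) has_real_derivative (1 / (1 + s) - 1 + s)) (at s)"
      using s by (auto intro!: derivative_eq_intros simp: algebra_simps)
    show "0 \<le> 1 / (1 + s) - 1 + s" using s by (simp add: field_simps)
  qed
  then have "(1 - p) * t + p\<^sup>2 / 2 \<le> ln (1 + t)" using True by (simp add: p_def)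
  then show ?thesis using assms(1) by (metis add_pos_nonneg exp_le_cancel_iff exp_ln zero_less_one)
next
  case False
  have "exp (1/2 :: real) \<le> 1 + 1/2 + (1/2)\<^sup>2" by (rule exp_bound) auto
  also have "\<dots> \<le> 1 + t" using False by (simp add: power2_eq_square)
  finally show ?thesis using False by (simp add: p_def)
qed

section \<open>Transport inequalities on a single probability space\<close>

context prob_space
begin

lemma integrable_bounded:
  fixes f :: "'a \<Rightarrow> real"
  assumes "f \<in> borel_measurable M" "\<And>x. x \<in> space M \<Longrightarrow> \<bar>f x\<bar> \<le> C"
  shows "integrable M f"
  by (rule integrable_const_bound[where B = C]) (use assms in auto)

text \<open>
  The hypothesis \<open>step\<close> bounds \<open>h\<close> by the inf-convolution of a convex \<open>g\<close> on an interval of length one,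
  tested at the points \<open>(1 - p) x + p y\<close>.
\<close>

lemma expectation_exp_neg_le:
  fixes g h :: "'a \<Rightarrow> real"
  assumes g: "integrable M g" "\<And>x. x \<in> space M \<Longrightarrow> c \<le> g x"
    and h: "integrable M h"
    and step: "\<And>x y p. x \<in> space M \<Longrightarrow> y \<in> space M \<Longrightarrow> p \<in> {0..1} \<Longrightarrow>
      h x \<le> (1 - p) * g x + p * g y + p\<^sup>2 / 2"
  shows "expectation (\<lambda>x. exp (- g x)) \<le> exp (- expectation h)"
proof -
  define m where "m = (INF x\<in>space M. g x)"
  have bdd: "bdd_below (g ` space M)" using g(2) by (auto intro!: bdd_belowI2)
  have m_le: "m \<le> g x" if "x \<in> space M" for x
    unfolding m_def by (rule cINF_lower[OF bdd that])
  \<comment> \<open>\<open>g\<close> need not attain its infimum, so \<open>g y\<close> is replaced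
    by \<open>m\<close> through the greatest-lower-bound property. This divides by \<open>p\<close>,
    which is why \<open>p = 0\<close> is treated apart.\<close>
  have hm: "h x \<le> (1 - p) * g x + p * m + p\<^sup>2 / 2" if x: "x \<in> space M" and p: "p \<in> {0..1}" for x p
  proof (cases "p = 0")
    case True then show ?thesis using step[OF x x p] by simp
  next
    case False
    have "(h x - (1 - p) * g x - p\<^sup>2 / 2) / p \<le> m"
      unfolding m_def
    proof (rule cINF_greatest)
      show "space M \<noteq> {}" by (rule not_empty)
      fix y assume "y \<in> space M"
      from step[OF x this p] show "(h x - (1 - p) * g x - p\<^sup>2 / 2) / p \<le> g y"
        using False p by (simp add: field_simps)
    qed
    then show ?thesis using False p by (simp add: field_simps)
  qed
  \<comment> \<open>Taking the optimal \<open>p = min t 1\<close> gives a bound affine in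
    \<open>h x\<close>, so integration turns \<open>h\<close> into its expectation;
    \<open>1 + s \<le> exp s\<close> then restores an exponential.\<close>
  have pw: "exp (- g x) \<le> exp (- m) * (1 - (h x - m))" if x: "x \<in> space M" for x
  proof -
    define t where "t = g x - m"
    have t: "0 \<le> t" using m_le[OF x] by (simp add: t_def)
    have "h x - m \<le> (1 - min t 1) * t + (min t 1)\<^sup>2 / 2"
      using hm[OF x, of "min t 1"] t by (simp add: t_def algebra_simps)
    then have "exp (- t) \<le> 1 - (h x - m)"
      using exp_neg_truncated_quadratic_le[OF t] by simp
    then have "exp (- m) * exp (- t) \<le> exp (- m) * (1 - (h x - m))" by simp
    then show ?thesis by (simp add: t_def flip: exp_add)
  qed
  have int: "integrable M (\<lambda>x. exp (- g x))"
    by (rule integrable_const_bound[where B = "exp (- c)"]) (use g in auto)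
  have "expectation (\<lambda>x. exp (- g x)) \<le> expectation (\<lambda>x. exp (- m) * (1 - (h x - m)))"
    by (rule integral_mono[OF int]) (use h pw in auto)
  also have "\<dots> = exp (- m) * (1 + - (expectation h - m))"
    using h by (simp add: prob_space)
  also have "\<dots> \<le> exp (- m) * exp (- (expectation h - m))"
    by (intro mult_left_mono exp_ge_add_one_self) auto
  finally show ?thesis by (simp flip: exp_add)
qed

text \<open>The companion bound for positive exponents. \<open>K\<close> is not written as an
  exponential because in the induction it is itself an average of exponentials over other
  coordinates.\<close>

lemma expectation_le_exp:
  fixes g K :: "'a \<Rightarrow> real"
  assumes g: "integrable M g" "\<And>x. x \<in> space M \<Longrightarrow> c \<le> g x"
    and K: "integrable M K"
    and step: "\<And>x y p. x \<in> space M \<Longrightarrow> y \<in> space M \<Longrightarrow> p \<in> {0..1} \<Longrightarrow>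
      K x \<le> exp ((1 - p) * g x + p * g y + p\<^sup>2 / 2)"
  shows "expectation K \<le> exp (expectation g)"
proof -
  define m where "m = (INF x\<in>space M. g x)"
  have bdd: "bdd_below (g ` space M)" using g(2) by (auto intro!: bdd_belowI2)
  have m_le: "m \<le> g x" if "x \<in> space M" for x
    unfolding m_def by (rule cINF_lower[OF bdd that])
  have Km: "K x \<le> exp ((1 - p) * g x + p * m + p\<^sup>2 / 2)" if x: "x \<in> space M" and p: "p \<in> {0..1}" for x p
  \<comment> \<open>A nonpositive \<open>K x\<close> lies below any exponential; otherwise the
    logarithm makes the bound affine in \<open>g y\<close>, and the infimum can be taken as
    before.\<close>
  proof (cases "p = 0 \<or> K x \<le> 0")
    case True then show ?thesis using step[OF x x p] by (auto intro: order_trans)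
  next
    case False
    then have K0: "0 < K x" and p0: "0 < p" using p by auto
    have "(ln (K x) - (1 - p) * g x - p\<^sup>2 / 2) / p \<le> m"
      unfolding m_def
    proof (rule cINF_greatest)
      show "space M \<noteq> {}" by (rule not_empty)
      fix y assume "y \<in> space M"
      from step[OF x this p] have "ln (K x) \<le> (1 - p) * g x + p * g y + p\<^sup>2 / 2"
        using K0 by (metis ln_exp ln_le_cancel_iff exp_gt_zero)
      then show "(ln (K x) - (1 - p) * g x - p\<^sup>2 / 2) / p \<le> g y"
        using p0 by (simp add: field_simps)
    qed
    then have "ln (K x) \<le> (1 - p) * g x + p * m + p\<^sup>2 / 2" using p0 by (simp add: field_simps)
    then show ?thesis using K0 by (metis exp_le_cancel_iff exp_ln)
  qed
  \<comment> \<open>Now the bound is affine in \<open>g x\<close>, so the expectation of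
    \<open>g\<close> appears after integration.\<close>
  have pw: "K x \<le> exp m * (1 + (g x - m))" if x: "x \<in> space M" for x
  proof -
    define t where "t = g x - m"
    have t: "0 \<le> t" using m_le[OF x] by (simp add: t_def)
    have "K x \<le> exp (m + ((1 - min t 1) * t + (min t 1)\<^sup>2 / 2))"
      using Km[OF x, of "min t 1"] t by (simp add: t_def algebra_simps)
    also have "\<dots> = exp m * exp ((1 - min t 1) * t + (min t 1)\<^sup>2 / 2)" by (rule exp_add)
    also have "\<dots> \<le> exp m * (1 + t)"
      using exp_truncated_quadratic_le[OF t] by simp
    finally show ?thesis by (simp add: t_def)
  qed
  have "expectation K \<le> expectation (\<lambda>x. exp m * (1 + (g x - m)))"
    by (rule integral_mono[OF K]) (use g pw in auto)
  also have "\<dots> = exp m * (1 + (expectation g - m))"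
    using g by (simp add: prob_space)
  also have "\<dots> \<le> exp m * exp (expectation g - m)"
    by (intro mult_left_mono exp_ge_add_one_self) auto
  finally show ?thesis by (simp flip: exp_add)
qed

end

section \<open>Tensorisation\<close>

lemma measurable_override_on:
  assumes "A \<subseteq> I"
    and f[measurable]: "f \<in> measurable N (PiM I M)" and g[measurable]: "g \<in> measurable N (PiM A M)"
  shows "(\<lambda>w. override_on (f w) (g w) A) \<in> measurable N (PiM I M)"
proof (rule measurable_PiM_single')
  fix i assume i: "i \<in> I"
  show "(\<lambda>w. override_on (f w) (g w) A i) \<in> measurable N (M i)"
    using i by (cases "i \<in> A") (simp_all add: override_on_def)
next
  show "(\<lambda>w i. override_on (f w) (g w) A i) \<in> space N \<rightarrow> (\<Pi>\<^sub>E i\<in>I. space (M i))"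
    using measurable_space[OF f] measurable_space[OF g] assms(1)
    by (fastforce simp: space_PiM override_on_def PiE_iff extensional_def)
qed

lemma override_on_insert_upd:
  "override_on z (x(k := y)) (insert k A) = override_on (z(k := y)) x (A - {k})"
  by (auto simp: override_on_def)

lemma override_on_upd_out:
  "k \<notin> A \<Longrightarrow> override_on (z(k := y)) x A = (override_on z x A)(k := y)"
  by (auto simp: override_on_def)

section \<open>Integrating out a subset of the coordinates\<close>

context product_prob_space
begin

text \<open>This is the conditional expectation given the coordinates outside \<open>A\<close>. The
  point \<open>z\<close> carries all coordinates, those in \<open>A\<close> being overwritten, so
  that the domain stays the same while \<open>A\<close> grows.\<close>

definition partial_expectation :: "'i set \<Rightarrow> (('i \<Rightarrow> 'a) \<Rightarrow> real) \<Rightarrow> ('i \<Rightarrow> 'a) \<Rightarrow> real" where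
  "partial_expectation A F z = (\<integral>x. F (override_on z x A) \<partial>PiM A M)"

lemma fun_upd_in_space_PiM:
  "z \<in> space (PiM I M) \<Longrightarrow> y \<in> space (M k) \<Longrightarrow> k \<in> I \<Longrightarrow> z(k := y) \<in> space (PiM I M)"
  by (auto simp: space_PiM PiE_iff extensional_def)

lemma override_on_in_space_PiM:
  "A \<subseteq> I \<Longrightarrow> z \<in> space (PiM I M) \<Longrightarrow> x \<in> space (PiM A M) \<Longrightarrow> override_on z x A \<in> space (PiM I M)"
  by (auto simp: space_PiM PiE_iff extensional_def override_on_def)

lemma partial_expectation_empty [simp]: "partial_expectation {} F z = F z"
  by (simp add: partial_expectation_def PiM_empty lebesgue_integral_count_space_finite)

lemma partial_expectation_all:
  assumes "z \<in> space (PiM I M)"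
  shows "partial_expectation I F z = (\<integral>x. F x \<partial>PiM I M)"
  unfolding partial_expectation_def
proof (rule Bochner_Integration.integral_cong[OF refl])
  fix x assume "x \<in> space (PiM I M)"
  then have "override_on z x I = x"
    using assms by (auto simp: space_PiM PiE_iff extensional_def override_on_def)
  then show "F (override_on z x I) = F x" by simp
qed

context
  fixes F :: "('i \<Rightarrow> 'a) \<Rightarrow> real" and C :: real
  assumes F [measurable]: "F \<in> borel_measurable (PiM I M)"
    and bounded: "\<And>z. z \<in> space (PiM I M) \<Longrightarrow> \<bar>F z\<bar> \<le> C"
begin

lemma integrable_override_on:
  assumes A: "A \<subseteq> I" and z: "z \<in> space (PiM I M)"
  shows "integrable (PiM A M) (\<lambda>x. F (override_on z x A))"
proof -
  interpret A: prob_space "PiM A M" by (rule prob_space_PiM) (rule prob_space)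
  have [measurable]: "(\<lambda>x. override_on z x A) \<in> measurable (PiM A M) (PiM I M)"
    by (rule measurable_override_on[OF A]) (use z in auto)
  show ?thesis
    by (rule A.integrable_bounded[where C = C])
       (use bounded override_on_in_space_PiM[OF A z] in auto)
qed

lemma abs_partial_expectation_le:
  assumes A: "A \<subseteq> I" and z: "z \<in> space (PiM I M)"
  shows "\<bar>partial_expectation A F z\<bar> \<le> C"
proof -
  interpret A: prob_space "PiM A M" by (rule prob_space_PiM) (rule prob_space)
  have "\<bar>partial_expectation A F z\<bar> \<le> (\<integral>x. \<bar>F (override_on z x A)\<bar> \<partial>PiM A M)"
    unfolding partial_expectation_def by (rule integral_abs_bound)
  also have "\<dots> \<le> (\<integral>x. C \<partial>PiM A M)"
    by (rule integral_mono)
       (use integrable_override_on[OF A z] bounded override_on_in_space_PiM[OF A z] in auto)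
  finally show ?thesis by (simp add: A.prob_space)
qed

lemma measurable_partial_expectation_upd:
  assumes A: "A \<subseteq> I" and k: "k \<in> I" and z: "z \<in> space (PiM I M)"
  shows "(\<lambda>y. partial_expectation A F (z(k := y))) \<in> borel_measurable (M k)"
proof -
  interpret A: prob_space "PiM A M" by (rule prob_space_PiM) (rule prob_space)
  have [measurable]: "(\<lambda>w. z(k := fst w)) \<in> measurable (M k \<Otimes>\<^sub>M PiM A M) (PiM I M)"
    by (rule measurable_fun_upd[where J = I]) (use k z in auto)
  have [measurable]: "(\<lambda>w. override_on (z(k := fst w)) (snd w) A) \<in> measurable (M k \<Otimes>\<^sub>M PiM A M) (PiM I M)"
    by (rule measurable_override_on[OF A]) auto
  show ?thesis
    unfolding partial_expectation_def
    by (rule A.borel_measurable_lebesgue_integral) (simp add: case_prod_unfold)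
qed

lemma integrable_partial_expectation_upd:
  assumes A: "A \<subseteq> I" and k: "k \<in> I" and z: "z \<in> space (PiM I M)"
  shows "integrable (M k) (\<lambda>y. partial_expectation A F (z(k := y)))"
  by (rule M.integrable_bounded[where C = C])
     (use measurable_partial_expectation_upd[OF assms] abs_partial_expectation_le[OF A]
       fun_upd_in_space_PiM[OF z] k in auto)

text \<open>The one-dimensional inequalities act on the new coordinate, so its integral must stand
  outermost. The product rule puts it innermost, and Fubini exchanges the two.\<close>

lemma partial_expectation_insert:
  assumes fin: "finite A" and A: "A \<subseteq> I" and k: "k \<in> I" "k \<notin> A" and z: "z \<in> space (PiM I M)"
  shows "partial_expectation (insert k A) F z = (\<integral>y. partial_expectation A F (z(k := y)) \<partial>M k)"
proof -
  interpret A: prob_space "PiM A M" by (rule prob_space_PiM) (rule prob_space)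
  interpret P: pair_prob_space "PiM A M" "M k" ..
  have [measurable]: "(\<lambda>w. z(k := snd w)) \<in> measurable (PiM A M \<Otimes>\<^sub>M M k) (PiM I M)"
    by (rule measurable_fun_upd[where J = I]) (use k z in auto)
  have meas [measurable]: "(\<lambda>w. override_on (z(k := snd w)) (fst w) A) \<in> measurable (PiM A M \<Otimes>\<^sub>M M k) (PiM I M)"
    by (rule measurable_override_on[OF A]) auto
  have int: "integrable (PiM A M \<Otimes>\<^sub>M M k) (\<lambda>(x, y). F (override_on (z(k := y)) x A))"
    by (rule P.integrable_bounded[where C = C])
       (use bounded override_on_in_space_PiM[OF A fun_upd_in_space_PiM[OF z _ k(1)]]
         in \<open>auto simp: case_prod_unfold space_pair_measure\<close>)
  have "partial_expectation (insert k A) F z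
      = (\<integral>x. (\<integral>y. F (override_on z (x(k := y)) (insert k A)) \<partial>M k) \<partial>PiM A M)"
    unfolding partial_expectation_def
    by (rule product_integral_insert[OF fin k(2) integrable_override_on]) (use A k z in auto)
  also have "\<dots> = (\<integral>x. (\<integral>y. F (override_on (z(k := y)) x A) \<partial>M k) \<partial>PiM A M)"
    using k(2) by (simp add: override_on_insert_upd)
  also have "\<dots> = (\<integral>y. (\<integral>x. F (override_on (z(k := y)) x A) \<partial>PiM A M) \<partial>M k)"
    using P.Fubini_integral[OF int] by simp
  finally show ?thesis by (simp add: partial_expectation_def)
qed

end

section \<open>Induction over the coordinates\<close>

context
  fixes f :: "'i set \<Rightarrow> ('i \<Rightarrow> 'a) \<Rightarrow> real" and C :: real
  assumes fin: "finite I"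
    and meas [measurable]: "\<And>A. f A \<in> borel_measurable (PiM I M)"
    and bounded: "\<And>A z. z \<in> space (PiM I M) \<Longrightarrow> \<bar>f A z\<bar> \<le> C"
    and step: "\<And>A k z x y p. A \<subseteq> I \<Longrightarrow> k \<in> I \<Longrightarrow> k \<notin> A \<Longrightarrow> z \<in> space (PiM I M) \<Longrightarrow>
      x \<in> space (M k) \<Longrightarrow> y \<in> space (M k) \<Longrightarrow> p \<in> {0..1} \<Longrightarrow>
      f (insert k A) (z(k := x)) \<le> (1 - p) * f A (z(k := x)) + p * f A (z(k := y)) + p\<^sup>2 / 2"
begin

text \<open>Think of \<open>f A\<close> as \<open>f {}\<close> after inf-convolution in the
  coordinates of \<open>A\<close>. For a new coordinate \<open>k\<close>, the induction hypothesis
  bounds the inner integral, and \<open>expectation_exp_neg_le\<close> on \<open>M k\<close> handles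
  the outer one.\<close>

lemma partial_exp_neg_le:
  assumes "finite A" "A \<subseteq> I" "z \<in> space (PiM I M)"
  shows "partial_expectation A (\<lambda>x. exp (- f {} x)) z \<le> exp (- partial_expectation A (f A) z)"
  using assms
proof (induction A arbitrary: z rule: finite_induct)
  case empty
  then show ?case by simp
next
  case (insert k A)
  then have A: "A \<subseteq> I" and k: "k \<in> I" and z: "z \<in> space (PiM I M)" by auto
  interpret A: prob_space "PiM A M" by (rule prob_space_PiM) (rule prob_space)
  let ?E = "\<lambda>x. exp (- f {} x)"
  let ?g = "\<lambda>y. partial_expectation A (f A) (z(k := y))"
  let ?h = "\<lambda>y. partial_expectation A (f (insert k A)) (z(k := y))"
  have E: "?E \<in> borel_measurable (PiM I M)" by measurable
  have bE: "\<bar>?E z\<bar> \<le> exp C" if "z \<in> space (PiM I M)" for z using bounded[OF that, of "{}"] by simp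
  have zk: "z(k := y) \<in> space (PiM I M)" if "y \<in> space (M k)" for y
    by (rule fun_upd_in_space_PiM[OF z that k])
  note int = integrable_partial_expectation_upd[OF meas bounded A k z]
  \<comment> \<open>Both points share the coordinates \<open>w\<close> in \<open>A\<close> and
    differ only in coordinate \<open>k\<close>, so \<open>step\<close> holds for each
    \<open>w\<close> and survives averaging.\<close>
  have gh: "?h x \<le> (1 - p) * ?g x + p * ?g y + p\<^sup>2 / 2"
    if xy: "x \<in> space (M k)" "y \<in> space (M k)" "p \<in> {0..1}" for x y p
  proof -
    note i = integrable_override_on[OF meas bounded A zk]
    have "?h x \<le> (\<integral>w. (1 - p) * f A (override_on (z(k := x)) w A)
        + p * f A (override_on (z(k := y)) w A) + p\<^sup>2 / 2 \<partial>PiM A M)"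
      unfolding partial_expectation_def
    proof (rule integral_mono)
      fix w assume "w \<in> space (PiM A M)"
      then show "f (insert k A) (override_on (z(k := x)) w A) \<le> (1 - p) * f A (override_on (z(k := x)) w A)
        + p * f A (override_on (z(k := y)) w A) + p\<^sup>2 / 2"
        using step[OF A k insert.hyps(2) override_on_in_space_PiM[OF A z] xy] insert.hyps(2)
        by (simp add: override_on_upd_out)
    qed (use i xy in auto)
    also have "\<dots> = (1 - p) * ?g x + p * ?g y + p\<^sup>2 / 2"
      using i xy by (simp add: partial_expectation_def A.prob_space)
    finally show ?thesis .
  qed
  have "partial_expectation (insert k A) ?E z = (\<integral>y. partial_expectation A ?E (z(k := y)) \<partial>M k)"
    by (rule partial_expectation_insert[OF E bE insert.hyps(1) A k insert.hyps(2) z])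
  also have "\<dots> \<le> (\<integral>y. exp (- ?g y) \<partial>M k)"
  proof (rule integral_mono)
    show "integrable (M k) (\<lambda>y. partial_expectation A ?E (z(k := y)))"
      by (rule integrable_partial_expectation_upd[OF E bE A k z])
    show "integrable (M k) (\<lambda>y. exp (- ?g y))"
    proof (rule M.integrable_bounded[where C = "exp C"])
      fix y assume "y \<in> space (M k)"
      from abs_partial_expectation_le[OF meas bounded A zk[OF this], of A]
      show "\<bar>exp (- ?g y)\<bar> \<le> exp C" by simp
    qed (use int in measurable)
    show "partial_expectation A ?E (z(k := y)) \<le> exp (- ?g y)" if "y \<in> space (M k)" for y
      by (rule insert.IH[OF A zk[OF that]])
  qed
  also have "\<dots> \<le> exp (- (\<integral>y. ?h y \<partial>M k))"
  proof (rule M.expectation_exp_neg_le[OF int _ int gh])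
    fix y assume "y \<in> space (M k)"
    from abs_partial_expectation_le[OF meas bounded A zk[OF this], of A]
    show "- C \<le> ?g y" by simp
  qed
  also have "(\<integral>y. ?h y \<partial>M k) = partial_expectation (insert k A) (f (insert k A)) z"
    by (rule partial_expectation_insert[OF meas bounded insert.hyps(1) A k insert.hyps(2) z, symmetric])
  finally show ?case .
qed

text \<open>Here the convolved function sits in the exponent on the left, so \<open>step\<close>
  cannot simply be averaged; the convexity of \<open>exp\<close> combines it with the induction
  hypothesis.\<close>

lemma partial_exp_le:
  assumes "finite A" "A \<subseteq> I" "z \<in> space (PiM I M)"
  shows "partial_expectation A (\<lambda>x. exp (f A x)) z \<le> exp (partial_expectation A (f {}) z)"
  using assms
proof (induction A arbitrary: z rule: finite_induct)
  case empty
  then show ?case by simp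
next
  case (insert k A)
  then have A: "A \<subseteq> I" and k: "k \<in> I" and z: "z \<in> space (PiM I M)" by auto
  interpret A: prob_space "PiM A M" by (rule prob_space_PiM) (rule prob_space)
  let ?E = "\<lambda>B x. exp (f B x)"
  let ?g = "\<lambda>y. partial_expectation A (f {}) (z(k := y))"
  let ?K = "\<lambda>y. partial_expectation A (?E (insert k A)) (z(k := y))"
  have E: "?E B \<in> borel_measurable (PiM I M)" for B by measurable
  have bE: "\<bar>?E B z\<bar> \<le> exp C" if "z \<in> space (PiM I M)" for z B using bounded[OF that, of B] by simp
  have zk: "z(k := y) \<in> space (PiM I M)" if "y \<in> space (M k)" for y
    by (rule fun_upd_in_space_PiM[OF z that k])
  note int = integrable_partial_expectation_upd[OF meas bounded A k z]
  have gK: "?K x \<le> exp ((1 - p) * ?g x + p * ?g y + p\<^sup>2 / 2)"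
    if xy: "x \<in> space (M k)" "y \<in> space (M k)" "p \<in> {0..1}" for x y p
  proof -
    note i = integrable_override_on[OF E bE A zk]
    define c where "c = (1 - p) * ?g x + p * ?g y + p\<^sup>2 / 2"
    \<comment> \<open>Normalised by \<open>exp (- ?g y)\<close>, the exponentials have integral at
      most \<open>1\<close> by the induction hypothesis. Convexity of \<open>exp\<close> then does
      the work of Hoelder's inequality.\<close>
    let ?r = "\<lambda>y w. exp (- ?g y) * ?E A (override_on (z(k := y)) w A)"
    have r: "(\<integral>w. ?r y w \<partial>PiM A M) \<le> 1" if y: "y \<in> space (M k)" for y
    proof -
      have "(\<integral>w. ?r y w \<partial>PiM A M) = exp (- ?g y) * partial_expectation A (?E A) (z(k := y))"
        by (simp add: partial_expectation_def)
      also have "\<dots> \<le> exp (- ?g y) * exp (?g y)"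
        by (intro mult_left_mono insert.IH[OF A zk[OF y]]) auto
      finally show ?thesis by (simp flip: exp_add)
    qed
    have "?K x \<le> (\<integral>w. exp c * ((1 - p) * ?r x w + p * ?r y w) \<partial>PiM A M)"
      unfolding partial_expectation_def[of A "?E (insert k A)"]
    proof (rule integral_mono)
      fix w assume w: "w \<in> space (PiM A M)"
      let ?fx = "f A (override_on (z(k := x)) w A)" and ?fy = "f A (override_on (z(k := y)) w A)"
      have "f (insert k A) (override_on (z(k := x)) w A) \<le> (1 - p) * ?fx + p * ?fy + p\<^sup>2 / 2"
        using step[OF A k insert.hyps(2) override_on_in_space_PiM[OF A z w] xy] insert.hyps(2)
        by (simp add: override_on_upd_out)
      also have "\<dots> = c + ((1 - p) * (?fx - ?g x) + p * (?fy - ?g y))"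
        by (simp add: c_def algebra_simps)
      finally have "exp (f (insert k A) (override_on (z(k := x)) w A))
          \<le> exp c * exp ((1 - p) * (?fx - ?g x) + p * (?fy - ?g y))"
        by (simp flip: exp_add)
      also have "\<dots> \<le> exp c * ((1 - p) * exp (?fx - ?g x) + p * exp (?fy - ?g y))"
        using convex_onD[OF exp_convex, of p "?fx - ?g x" "?fy - ?g y"] xy by simp
      also have "\<dots> = exp c * ((1 - p) * ?r x w + p * ?r y w)"
        by (simp add: exp_diff exp_minus field_simps)
      finally show "exp (f (insert k A) (override_on (z(k := x)) w A)) \<le> \<dots>" .
    qed (use i xy in auto)
    also have "\<dots> = exp c * ((1 - p) * (\<integral>w. ?r x w \<partial>PiM A M) + p * (\<integral>w. ?r y w \<partial>PiM A M))"
      using i xy by simp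
    also have "\<dots> \<le> exp c * ((1 - p) * 1 + p * 1)"
      by (intro mult_left_mono add_mono r) (use xy in auto)
    finally show ?thesis by (simp add: c_def)
  qed
  have "partial_expectation (insert k A) (?E (insert k A)) z = (\<integral>y. ?K y \<partial>M k)"
    by (rule partial_expectation_insert[OF E bE insert.hyps(1) A k insert.hyps(2) z])
  also have "\<dots> \<le> exp (\<integral>y. ?g y \<partial>M k)"
  proof (rule M.expectation_le_exp[OF int _ integrable_partial_expectation_upd[OF E bE A k z] gK])
    fix y assume "y \<in> space (M k)"
    from abs_partial_expectation_le[OF meas bounded A zk[OF this], of "{}"]
    show "- C \<le> ?g y" by simp
  qed
  also have "(\<integral>y. ?g y \<partial>M k) = partial_expectation (insert k A) (f {}) z"
    by (rule partial_expectation_insert[OF meas bounded insert.hyps(1) A k insert.hyps(2) z, symmetric])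
  finally show ?case .
qed

lemma integral_exp_neg_le: "(\<integral>x. exp (- f {} x) \<partial>PiM I M) \<le> exp (- (\<integral>x. f I x \<partial>PiM I M))"
  and integral_exp_le: "(\<integral>x. exp (f I x) \<partial>PiM I M) \<le> exp (\<integral>x. f {} x \<partial>PiM I M)"
proof -
  \<comment> \<open>Any base point serves, since integrating out all of \<open>I\<close> overwrites
    every coordinate of \<open>z\<close> in \<open>I\<close>.\<close>
  obtain z where z: "z \<in> space (PiM I M)" using P.not_empty by blast
  show "(\<integral>x. exp (- f {} x) \<partial>PiM I M) \<le> exp (- (\<integral>x. f I x \<partial>PiM I M))"
    using partial_exp_neg_le[OF fin subset_refl z] by (simp add: partial_expectation_all[OF z])
  show "(\<integral>x. exp (f I x) \<partial>PiM I M) \<le> exp (\<integral>x. f {} x \<partial>PiM I M)"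
    using partial_exp_le[OF fin subset_refl z] by (simp add: partial_expectation_all[OF z])
qed

end

end

section \<open>Weighted square deviations\<close>

definition weighted_mean :: "'i set \<Rightarrow> ('i \<Rightarrow> real) \<Rightarrow> ('i \<Rightarrow> real) \<Rightarrow> real" where
  "weighted_mean I w x = (\<Sum>i\<in>I. w i * x i) / sum w I"

text \<open>The minimum over centres is written out at its minimiser, which makes measurability
  immediate; \<open>weighted_square_dev_le\<close> recovers minimality.\<close>

definition weighted_square_dev :: "'i set \<Rightarrow> ('i \<Rightarrow> real) \<Rightarrow> ('i \<Rightarrow> real) \<Rightarrow> real" where
  "weighted_square_dev I w x = (\<Sum>i\<in>I. w i * (x i - weighted_mean I w x)\<^sup>2)"

text \<open>The parallel axis identity: moving the centre from the mean \<open>m\<close> to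
  \<open>c\<close> adds exactly \<open>(m - c)\<^sup>2 * sum w I\<close>.\<close>

lemma weighted_square_dev_le:
  assumes "0 < sum w I"
  shows "weighted_square_dev I w x \<le> (\<Sum>i\<in>I. w i * (x i - c)\<^sup>2)"
proof -
  define m where "m = weighted_mean I w x"
  have m: "(\<Sum>i\<in>I. w i * x i) = m * sum w I"
    using assms by (simp add: m_def weighted_mean_def)
  have "(\<Sum>i\<in>I. w i * (x i - c)\<^sup>2)
      = (\<Sum>i\<in>I. w i * (x i - m)\<^sup>2 + 2 * (m - c) * (w i * x i) + (c\<^sup>2 - m\<^sup>2) * w i)"
    by (intro sum.cong refl) (simp add: power2_eq_square algebra_simps)
  also have "\<dots> = weighted_square_dev I w x + 2 * (m - c) * (m * sum w I) + (c\<^sup>2 - m\<^sup>2) * sum w I"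
    by (simp add: sum.distrib weighted_square_dev_def m_def[symmetric] m flip: sum_distrib_left)
  also have "\<dots> = weighted_square_dev I w x + (m - c)\<^sup>2 * sum w I"
    by (simp add: power2_eq_square algebra_simps)
  finally show ?thesis using assms by simp
qed

lemma square_convex_comb_le:
  fixes a b p :: real
  assumes "p \<in> {0..1}"
  shows "((1 - p) * a + p * b)\<^sup>2 \<le> (1 - p) * a\<^sup>2 + p * b\<^sup>2"
proof -
  have "(1 - p) * a\<^sup>2 + p * b\<^sup>2 - ((1 - p) * a + p * b)\<^sup>2 = p * (1 - p) * (a - b)\<^sup>2"
    by (simp add: power2_eq_square algebra_simps)
  moreover have "0 \<le> p * (1 - p) * (a - b)\<^sup>2" using assms by simp
  ultimately show ?thesis by linarith
qed

text \<open>The two sides differ by \<open>(t * a - b)\<^sup>2 / (1 + t)\<close>. This is the source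
  of the weight change from \<open>t\<close> to \<open>t / (1 + t)\<close>.\<close>

lemma scaled_square_inf_convolution_le:
  fixes a b t :: real
  assumes "0 < t"
  shows "t / (1 + t) * (a + b)\<^sup>2 \<le> t * a\<^sup>2 + b\<^sup>2"
proof -
  have "(1 + t) * (t * a\<^sup>2 + b\<^sup>2) - t * (a + b)\<^sup>2 = (t * a - b)\<^sup>2"
    by (simp add: power2_eq_square algebra_simps)
  then have "t * (a + b)\<^sup>2 \<le> (1 + t) * (t * a\<^sup>2 + b\<^sup>2)"
    by (metis diff_ge_0_iff_ge zero_le_power2)
  then show ?thesis using assms by (simp add: field_simps)
qed

lemma weighted_square_dev_upd_le:
  assumes fin: "finite I" and k: "k \<in> I" and w: "\<And>i. i \<in> I \<Longrightarrow> 0 < w i"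
    and p: "p \<in> {0..1}" and xy: "\<bar>x - y\<bar> \<le> 1"
  shows "weighted_square_dev I (w(k := w k / (1 + w k))) (z(k := x)) \<le>
    (1 - p) * weighted_square_dev I w (z(k := x)) + p * weighted_square_dev I w (z(k := y)) + p\<^sup>2"
proof -
  define a where "a = weighted_mean I w (z(k := x))"
  define b where "b = weighted_mean I w (z(k := y))"
  \<comment> \<open>The deviation at the left is tested at the mixture of the two optimal centres.
    Coordinates other than \<open>k\<close> then need only convexity of the square.\<close>
  define c where "c = (1 - p) * a + p * b"
  let ?w = "w(k := w k / (1 + w k))"
  let ?J = "I - {k}"
  have wk: "0 < w k" using w k by simp
  have "0 < ?w i" if "i \<in> I" for i using w[OF that] wk by simp
  then have "0 < sum ?w I" using k fin by (intro sum_pos) auto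
  then have "weighted_square_dev I ?w (z(k := x)) \<le> (\<Sum>i\<in>I. ?w i * ((z(k := x)) i - c)\<^sup>2)"
    by (rule weighted_square_dev_le)
  also have "\<dots> = w k / (1 + w k) * (x - c)\<^sup>2 + (\<Sum>i\<in>?J. w i * (z i - c)\<^sup>2)"
    using fin k by (simp add: sum.remove)
  also have "\<dots> \<le> ((1 - p) * (w k * (x - a)\<^sup>2) + p * (w k * (y - b)\<^sup>2) + p\<^sup>2)
      + (\<Sum>i\<in>?J. (1 - p) * (w i * (z i - a)\<^sup>2) + p * (w i * (z i - b)\<^sup>2))"
  proof (intro add_mono sum_mono)
    fix i assume "i \<in> ?J"
    then have "w i * ((1 - p) * (z i - a) + p * (z i - b))\<^sup>2 \<le> w i * ((1 - p) * (z i - a)\<^sup>2 + p * (z i - b)\<^sup>2)"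
      by (intro mult_left_mono square_convex_comb_le[OF p]) (use w in \<open>auto intro: less_imp_le\<close>)
    moreover have "(1 - p) * (z i - a) + p * (z i - b) = z i - c"
      by (simp add: c_def algebra_simps)
    ultimately have "w i * (z i - c)\<^sup>2 \<le> w i * ((1 - p) * (z i - a)\<^sup>2 + p * (z i - b)\<^sup>2)"
      by simp
    then show "w i * (z i - c)\<^sup>2 \<le> (1 - p) * (w i * (z i - a)\<^sup>2) + p * (w i * (z i - b)\<^sup>2)"
      by (simp add: algebra_simps)
  next
    let ?v = "(1 - p) * (x - a) + p * (y - b)"
    \<comment> \<open>In coordinate \<open>k\<close> the displacement \<open>p * (x - y)\<close> is
      split off. The reduced weight absorbs it at the cost of its square, at most
      \<open>p\<^sup>2\<close>.\<close>
    have "x - c = ?v + p * (x - y)" by (simp add: c_def algebra_simps)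
    then have "w k / (1 + w k) * (x - c)\<^sup>2 \<le> w k * ?v\<^sup>2 + (p * (x - y))\<^sup>2"
      using scaled_square_inf_convolution_le[OF wk] by metis
    also have "w k * ?v\<^sup>2 \<le> w k * ((1 - p) * (x - a)\<^sup>2 + p * (y - b)\<^sup>2)"
      by (intro mult_left_mono square_convex_comb_le[OF p]) (use wk in auto)
    also have "(p * (x - y))\<^sup>2 \<le> p\<^sup>2"
    proof -
      have "(x - y)\<^sup>2 \<le> 1" using xy by (simp add: abs_square_le_1)
      then have "p\<^sup>2 * (x - y)\<^sup>2 \<le> p\<^sup>2 * 1" by (intro mult_left_mono) auto
      then show ?thesis by (simp add: power_mult_distrib)
    qed
    finally show "w k / (1 + w k) * (x - c)\<^sup>2 \<le> (1 - p) * (w k * (x - a)\<^sup>2) + p * (w k * (y - b)\<^sup>2) + p\<^sup>2"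
      by (simp add: algebra_simps)
  qed
  also have "\<dots> = (1 - p) * (w k * (x - a)\<^sup>2 + (\<Sum>i\<in>?J. w i * (z i - a)\<^sup>2))
      + p * (w k * (y - b)\<^sup>2 + (\<Sum>i\<in>?J. w i * (z i - b)\<^sup>2)) + p\<^sup>2"
    by (simp add: sum.distrib distrib_left flip: sum_distrib_left)
  also have "w k * (x - a)\<^sup>2 + (\<Sum>i\<in>?J. w i * (z i - a)\<^sup>2) = weighted_square_dev I w (z(k := x))"
    using fin k by (simp add: weighted_square_dev_def a_def[symmetric] sum.remove)
  also have "w k * (y - b)\<^sup>2 + (\<Sum>i\<in>?J. w i * (z i - b)\<^sup>2) = weighted_square_dev I w (z(k := y))"
    using fin k by (simp add: weighted_square_dev_def b_def[symmetric] sum.remove)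
  finally show ?thesis .
qed

lemma weighted_square_dev_const:
  assumes "t \<noteq> 0"
  shows "weighted_square_dev I (\<lambda>_. t) x = t * weighted_square_dev I (\<lambda>_. 1) x"
  using assms
  by (simp add: weighted_square_dev_def weighted_mean_def sum_distrib_left flip: sum_distrib_left)

lemma weighted_square_dev_cong:
  assumes "\<And>i. i \<in> I \<Longrightarrow> w i = w' i" "\<And>i. i \<in> I \<Longrightarrow> x i = x' i"
  shows "weighted_square_dev I w x = weighted_square_dev I w' x'"
  using assms by (simp add: weighted_square_dev_def weighted_mean_def cong: sum.cong)

lemma weighted_square_dev_nonneg:
  "(\<And>i. i \<in> I \<Longrightarrow> 0 \<le> w i) \<Longrightarrow> 0 \<le> weighted_square_dev I w x"
  by (auto simp: weighted_square_dev_def intro!: sum_nonneg)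

text \<open>Comparison with the centre \<open>0\<close>. The bound is crude but gives the
  boundedness needed for integrability.\<close>

lemma weighted_square_dev_le_card:
  assumes "finite I" "\<And>i. i \<in> I \<Longrightarrow> 0 < w i" "\<And>i. i \<in> I \<Longrightarrow> w i \<le> t" "\<And>i. i \<in> I \<Longrightarrow> x i \<in> {0..1}"
  shows "weighted_square_dev I w x \<le> t * card I"
proof (cases "I = {}")
  case True
  then show ?thesis by (simp add: weighted_square_dev_def)
next
  case False
  then have "0 < sum w I" using assms by (intro sum_pos) auto
  then have "weighted_square_dev I w x \<le> (\<Sum>i\<in>I. w i * (x i - 0)\<^sup>2)"
    by (rule weighted_square_dev_le)
  also have "\<dots> \<le> (\<Sum>i\<in>I. t * 1)"
  proof (intro sum_mono mult_mono)
    fix i assume i: "i \<in> I"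
    show "(x i - 0)\<^sup>2 \<le> 1" using assms(4)[OF i] by (simp add: abs_square_le_1)
    show "0 \<le> t" using assms(2,3)[OF i] by simp
  qed (use assms in auto)
  finally show ?thesis by (simp add: mult.commute)
qed

text \<open>By independence the joint law is the product of the marginal laws, and the tensorised
  inequalities apply there to a family of weighted deviations.\<close>

lemma (in prob_space) expectation_exp_square_dev:
  fixes X :: "'i \<Rightarrow> 'a \<Rightarrow> real" and t :: real and I :: "'i set"
  assumes fin: "finite I" and ne: "I \<noteq> {}" and indep: "indep_vars (\<lambda>_. borel) X I"
    and X01: "\<And>i \<omega>. i \<in> I \<Longrightarrow> \<omega> \<in> space M \<Longrightarrow> X i \<omega> \<in> {0..1}" and t: "0 < t"
  defines "W \<equiv> \<lambda>\<omega>. weighted_square_dev I (\<lambda>_. 1) (\<lambda>i. X i \<omega>)"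
  shows "expectation (\<lambda>\<omega>. exp (- (t * W \<omega> / 2))) \<le> exp (- (t / (1 + t) * expectation W / 2))"
    and "expectation (\<lambda>\<omega>. exp (t / (1 + t) * W \<omega> / 2)) \<le> exp (t * expectation W / 2)"
proof -
  \<comment> \<open>Restricting the state space to \<open>[0, 1]\<close> makes the bounds hold at
    every point of the product, not merely almost everywhere.\<close>
  define R where "R = restrict_space borel {0..1::real}"
  \<comment> \<open>The default \<open>0\<close> outside \<open>I\<close> makes \<open>N i\<close> a
    probability space for every index, as the product locale demands.\<close>
  define X' where "X' i = (if i \<in> I then X i else (\<lambda>_. 0))" for i
  define N where "N i = distr M R (X' i)" for i
  have rv: "random_variable borel (X i)" if "i \<in> I" for i
    using indep that by (auto simp: indep_vars_def)
  have XR: "random_variable R (X i)" if "i \<in> I" for i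
    unfolding R_def by (rule measurable_restrict_space2) (use rv X01 that in auto)
  have X'R [measurable]: "random_variable R (X' i)" for i
    unfolding R_def by (rule measurable_restrict_space2) (use rv X01 in \<open>auto simp: X'_def\<close>)
  have spN [simp]: "space (N i) = {0..1}" for i by (simp add: N_def R_def space_restrict_space)
  have setsN: "sets (N i) = sets R" for i by (simp add: N_def)
  have "prob_space (N i)" for i unfolding N_def by (rule prob_space_distr) simp
  then interpret N: product_prob_space N I
    by (auto simp: product_prob_space_def product_prob_space_axioms_def product_sigma_finite_def
      intro: prob_space_imp_sigma_finite)
  have setsP: "sets (PiM I N) = sets (PiM I (\<lambda>_. R))"
    by (rule sets_PiM_cong) (simp_all add: setsN)
  have indepR: "indep_vars (\<lambda>_. R) X I"
    unfolding indep_vars_def2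
  proof (intro conjI ballI XR)
    have "indep_sets (\<lambda>i. {X i -` A \<inter> space M |A. A \<in> sets borel}) I"
      using indep by (auto simp: indep_vars_def2)
    moreover have "sets R \<subseteq> sets borel" by (auto simp: R_def sets_restrict_space)
    ultimately show "indep_sets (\<lambda>i. {X i -` A \<inter> space M |A. A \<in> sets R}) I"
      by (elim indep_sets_mono_sets) auto
  qed
  have "distr M (PiM I (\<lambda>_. R)) (\<lambda>\<omega>. \<lambda>i\<in>I. X i \<omega>) = PiM I (\<lambda>i. distr M R (X i))"
    using indep_vars_iff_distr_eq_PiM'[OF ne, where M' = "\<lambda>_. R" and X = X] XR indepR by simp
  also have "\<dots> = PiM I N" by (rule PiM_cong) (simp_all add: N_def X'_def)
  finally have distr: "PiM I N = distr M (PiM I (\<lambda>_. R)) (\<lambda>\<omega>. \<lambda>i\<in>I. X i \<omega>)" ..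
  have rvP: "(\<lambda>\<omega>. \<lambda>i\<in>I. X i \<omega>) \<in> measurable M (PiM I (\<lambda>_. R))"
    by (rule measurable_restrict) (rule XR)

  \<comment> \<open>Coordinates in \<open>A\<close> have already been convolved. The factor
    \<open>1/2\<close> in \<open>f\<close> below turns the cost \<open>p\<^sup>2\<close> into
    \<open>p\<^sup>2 / 2\<close>.\<close>
  define wt where "wt A i = (if i \<in> A then t / (1 + t) else t)" for A :: "'i set" and i
  define f where "f A x = weighted_square_dev I (wt A) x / 2" for A :: "'i set" and x
  have wt: "0 < wt A i" "wt A i \<le> t" for A i
    using t by (auto simp: wt_def field_simps)
  have comp [measurable]: "(\<lambda>x. x i) \<in> borel_measurable (PiM I N)" if "i \<in> I" for i
  proof -
    have "(\<lambda>x. x) \<in> borel_measurable R"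
      unfolding R_def by (rule measurable_restrict_space1) simp
    then have "(\<lambda>x. x) \<in> borel_measurable (N i)"
      using measurable_cong_sets[OF setsN refl] by blast
    with measurable_component_singleton[OF that]
    show ?thesis by (rule measurable_compose[where g = "\<lambda>x. x"])
  qed
  have meas [measurable]: "f A \<in> borel_measurable (PiM I N)" for A
    unfolding f_def weighted_square_dev_def weighted_mean_def by measurable
  have sp: "z i \<in> {0..1}" if "z \<in> space (PiM I N)" "i \<in> I" for z i
    using that unfolding space_PiM by (auto dest!: PiE_mem[of z I _ i])
  have bounded: "\<bar>f A z\<bar> \<le> t * card I" if "z \<in> space (PiM I N)" for A z
    using weighted_square_dev_le_card[OF fin, of "wt A" t z] sp[OF that] wt
      weighted_square_dev_nonneg[of I "wt A" z]
    by (simp add: f_def less_imp_le)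
  have step: "f (insert k A) (z(k := x)) \<le> (1 - p) * f A (z(k := x)) + p * f A (z(k := y)) + p\<^sup>2 / 2"
    if "k \<in> I" "k \<notin> A" "x \<in> space (N k)" "y \<in> space (N k)" "p \<in> {0..1}" for A k z x y p
  proof -
    have "wt (insert k A) = (wt A)(k := wt A k / (1 + wt A k))"
      using that(2) by (auto simp: wt_def)
    moreover have "\<bar>x - y\<bar> \<le> 1" using that by auto
    ultimately show ?thesis
      using weighted_square_dev_upd_le[where w = "wt A" and x = x and y = y and z = z, OF fin that(1) wt(1) that(5)] by (simp add: f_def)
  qed

  have int: "(\<integral>x. F x \<partial>PiM I N) = expectation (\<lambda>\<omega>. F (\<lambda>i\<in>I. X i \<omega>))"
    if "F \<in> borel_measurable (PiM I N)" for F :: "('i \<Rightarrow> real) \<Rightarrow> real"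
  proof -
    have "F \<in> borel_measurable (PiM I (\<lambda>_. R))"
      using that measurable_cong_sets[OF setsP refl] by blast
    then show ?thesis unfolding distr by (rule integral_distr[OF rvP])
  qed
  have f_empty: "f {} (\<lambda>i\<in>I. X i \<omega>) = t * W \<omega> / 2" for \<omega>
  proof -
    have "weighted_square_dev I (wt {}) (\<lambda>i\<in>I. X i \<omega>) = weighted_square_dev I (\<lambda>_. t) (\<lambda>i. X i \<omega>)"
      by (rule weighted_square_dev_cong) (auto simp: wt_def)
    then show ?thesis using t weighted_square_dev_const[of t I] by (simp add: f_def W_def)
  qed
  have f_all: "f I (\<lambda>i\<in>I. X i \<omega>) = t / (1 + t) * W \<omega> / 2" for \<omega>
  proof -
    have "weighted_square_dev I (wt I) (\<lambda>i\<in>I. X i \<omega>)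
        = weighted_square_dev I (\<lambda>_. t / (1 + t)) (\<lambda>i. X i \<omega>)"
      by (rule weighted_square_dev_cong) (auto simp: wt_def)
    then show ?thesis using t weighted_square_dev_const[of "t / (1 + t)" I] by (simp add: f_def W_def)
  qed
  have "(\<integral>x. exp (- f {} x) \<partial>PiM I N) \<le> exp (- (\<integral>x. f I x \<partial>PiM I N))"
    by (rule N.integral_exp_neg_le[OF fin meas bounded step])
  then show "expectation (\<lambda>\<omega>. exp (- (t * W \<omega> / 2))) \<le> exp (- (t / (1 + t) * expectation W / 2))"
    by (simp add: int f_empty f_all)
  have "(\<integral>x. exp (f I x) \<partial>PiM I N) \<le> exp (\<integral>x. f {} x \<partial>PiM I N)"
    by (rule N.integral_exp_le[OF fin meas bounded step])
  then show "expectation (\<lambda>\<omega>. exp (t / (1 + t) * W \<omega> / 2)) \<le> exp (t * expectation W / 2)"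
    by (simp add: int f_empty f_all)
qed

section \<open>Tails of the sample variance\<close>

text \<open>Both sides expand to \<open>N * Q - S\<^sup>2\<close>, with \<open>S\<close> the sum,
  \<open>Q\<close> the sum of squares and \<open>N\<close> the cardinality.\<close>

lemma sum_sum_square_diff_eq:
  fixes x :: "'i \<Rightarrow> real"
  assumes "finite I" "I \<noteq> {}"
  shows "(\<Sum>i\<in>I. \<Sum>j\<in>I. (x i - x j)\<^sup>2 / 2) = card I * weighted_square_dev I (\<lambda>_. 1) x"
proof -
  define S where "S = (\<Sum>i\<in>I. x i)"
  define Q where "Q = (\<Sum>i\<in>I. (x i)\<^sup>2)"
  define N where "N = real (card I)"
  have N: "0 < N" using assms by (simp add: N_def card_gt_0_iff)
  define m where "m = S / N"
  have "(\<Sum>i\<in>I. \<Sum>j\<in>I. (x i - x j)\<^sup>2 / 2) = (\<Sum>i\<in>I. \<Sum>j\<in>I. (x i)\<^sup>2 / 2 + (x j)\<^sup>2 / 2 - x i * x j)"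
    by (intro sum.cong refl) (simp add: power2_eq_square field_simps)
  also have "\<dots> = (\<Sum>i\<in>I. N * (x i)\<^sup>2 / 2 + Q / 2 - x i * S)"
    by (simp add: sum.distrib sum_subtractf N_def Q_def S_def flip: sum_divide_distrib sum_distrib_left)
  also have "\<dots> = N * Q / 2 + N * (Q / 2) - S * S"
    by (simp add: sum.distrib sum_subtractf flip: sum_divide_distrib sum_distrib_left
        sum_distrib_right Q_def S_def N_def)
  also have "\<dots> = N * Q - S\<^sup>2" by (simp add: power2_eq_square)
  finally have pairs: "(\<Sum>i\<in>I. \<Sum>j\<in>I. (x i - x j)\<^sup>2 / 2) = N * Q - S\<^sup>2" .
  have "weighted_square_dev I (\<lambda>_. 1) x = (\<Sum>i\<in>I. (x i - m)\<^sup>2)"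
    by (simp add: weighted_square_dev_def weighted_mean_def m_def S_def N_def)
  also have "\<dots> = (\<Sum>i\<in>I. (x i)\<^sup>2 - 2 * m * x i + m\<^sup>2)"
    by (intro sum.cong refl) (simp add: power2_eq_square algebra_simps)
  also have "\<dots> = Q - 2 * m * S + N * m\<^sup>2"
    by (simp add: sum.distrib sum_subtractf flip: sum_distrib_left Q_def S_def N_def)
  finally have "card I * weighted_square_dev I (\<lambda>_. 1) x = N * Q - S\<^sup>2"
    using N by (simp add: m_def power2_eq_square field_simps flip: N_def)
  with pairs show ?thesis by simp
qed

lemma sample_variance_eq:
  assumes "2 \<le> n"
  shows "sample_variance n x = weighted_square_dev {1..n} (\<lambda>_. 1) x / (real n - 1)"
  using assms sum_sum_square_diff_eq[of "{1..n}" x] by (simp add: sample_variance_def)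

section \<open>Chernoff bounds for the square root of a nonnegative variable\<close>

context prob_space
begin

lemma sqrt_lower_tail:
  fixes W :: "'a \<Rightarrow> real"
  assumes W: "integrable M W" "\<And>\<omega>. \<omega> \<in> space M \<Longrightarrow> 0 \<le> W \<omega>" and u: "0 < u"
    and mgf: "\<And>t. 0 < t \<Longrightarrow>
      expectation (\<lambda>\<omega>. exp (- (t * W \<omega> / 2))) \<le> exp (- (t / (1 + t) * expectation W / 2))"
  shows "prob {\<omega> \<in> space M. sqrt (expectation W) > sqrt (W \<omega>) + u} \<le> exp (- (u\<^sup>2 / 2))"
proof -
  define s where "s = sqrt (expectation W)"
  have EW: "0 \<le> expectation W" by (rule Bochner_Integration.integral_nonneg) (rule W)
  then have s2: "expectation W = s\<^sup>2" by (simp add: s_def)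
  note [measurable] = borel_measurable_integrable[OF W(1)]
  show ?thesis
  proof (cases "u < s")
    case False
    have "{\<omega> \<in> space M. s > sqrt (W \<omega>) + u} = {}"
      using False W(2) real_sqrt_ge_zero by fastforce
    then show ?thesis unfolding s_def[symmetric] by (simp only: measure_empty exp_ge_zero)
  next
    case True
    \<comment> \<open>The minimiser of the Chernoff exponent
      \<open>t / 2 * (s - u)\<^sup>2 - t / (1 + t) * s\<^sup>2 / 2\<close>, at which
      \<open>1 + t = s / (s - u)\<close>. It requires \<open>u < s\<close>; otherwise the event is
      empty.\<close>
    define t where "t = u / (s - u)"
    have t: "0 < t" using True u by (simp add: t_def)
    have tt: "t / (1 + t) = u / s" using True u by (simp add: t_def field_simps)
    have int: "integrable M (\<lambda>\<omega>. exp (- (t / 2) * W \<omega>))"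
      by (rule integrable_bounded[where C = 1]) (use W(2) t in auto)
    have "prob {\<omega> \<in> space M. s > sqrt (W \<omega>) + u} \<le> prob {\<omega> \<in> space M. W \<omega> \<le> (s - u)\<^sup>2}"
    proof (rule finite_measure_mono)
      show "{\<omega> \<in> space M. s > sqrt (W \<omega>) + u} \<subseteq> {\<omega> \<in> space M. W \<omega> \<le> (s - u)\<^sup>2}"
      proof clarify
        fix \<omega> assume "\<omega> \<in> space M" "s > sqrt (W \<omega>) + u"
        then have "(sqrt (W \<omega>))\<^sup>2 \<le> (s - u)\<^sup>2" using W(2) by (intro power_mono) auto
        then show "W \<omega> \<le> (s - u)\<^sup>2" using W(2)[OF \<open>\<omega> \<in> space M\<close>] by simp
      qed
    qed simp
    also have "\<dots> \<le> exp (t / 2 * (s - u)\<^sup>2) * expectation (\<lambda>\<omega>. exp (- (t / 2) * W \<omega>))"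
      using Chernoff_ineq_le[of "t / 2" "space M" W "(s - u)\<^sup>2"] t int
      by (simp add: set_integrable_def set_integral_space integrable_mult_indicator flip: real_scaleR_def)
    also have "\<dots> \<le> exp (t / 2 * (s - u)\<^sup>2) * exp (- (u / s * s\<^sup>2 / 2))"
      using mgf[OF t] by (simp add: tt s2)
    also have "\<dots> = exp (t / 2 * (s - u)\<^sup>2 - u / s * s\<^sup>2 / 2)" by (simp flip: exp_add)
    also have "t / 2 * (s - u)\<^sup>2 - u / s * s\<^sup>2 / 2 = - (u\<^sup>2 / 2)"
      using True u by (simp add: t_def power2_eq_square field_simps)
    finally show ?thesis by (simp add: s_def)
  qed
qed

lemma sqrt_upper_tail:
  fixes W :: "'a \<Rightarrow> real"
  assumes W: "integrable M W" "\<And>\<omega>. \<omega> \<in> space M \<Longrightarrow> 0 \<le> W \<omega>" "\<And>\<omega>. \<omega> \<in> space M \<Longrightarrow> W \<omega> \<le> C"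
    and u: "0 < u"
    and mgf: "\<And>t. 0 < t \<Longrightarrow>
      expectation (\<lambda>\<omega>. exp (t / (1 + t) * W \<omega> / 2)) \<le> exp (t * expectation W / 2)"
  shows "prob {\<omega> \<in> space M. sqrt (W \<omega>) > sqrt (expectation W) + u} \<le> exp (- (u\<^sup>2 / 2))"
proof -
  define s where "s = sqrt (expectation W)"
  have EW: "0 \<le> expectation W" by (rule Bochner_Integration.integral_nonneg) (rule W)
  then have s2: "expectation W = s\<^sup>2" and s0: "0 \<le> s" by (simp_all add: s_def)
  note [measurable] = borel_measurable_integrable[OF W(1)]
  have "prob {\<omega> \<in> space M. sqrt (W \<omega>) > s + u} \<le> prob {\<omega> \<in> space M. W \<omega> \<ge> (s + u)\<^sup>2}"
  proof (rule finite_measure_mono)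
    show "{\<omega> \<in> space M. sqrt (W \<omega>) > s + u} \<subseteq> {\<omega> \<in> space M. W \<omega> \<ge> (s + u)\<^sup>2}"
    proof clarify
      fix \<omega> assume "\<omega> \<in> space M" "sqrt (W \<omega>) > s + u"
      then have "(s + u)\<^sup>2 \<le> (sqrt (W \<omega>))\<^sup>2" using s0 u by (intro power_mono) auto
      then show "(s + u)\<^sup>2 \<le> W \<omega>" using W(2)[OF \<open>\<omega> \<in> space M\<close>] by simp
    qed
  qed simp
  also have "\<dots> \<le> exp (- (u\<^sup>2 / 2))"
  \<comment> \<open>The optimal \<open>t = u / s\<close> below needs \<open>s > 0\<close>. If the
    mean vanishes, Markov's inequality already gives probability zero.\<close>
  proof (cases "s = 0")
    case True
    have "prob {\<omega> \<in> space M. W \<omega> \<ge> (s + u)\<^sup>2} \<le> expectation W / (s + u)\<^sup>2"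
      by (rule integral_Markov_inequality_measure[where A = "{}"]) (use W u True in auto)
    also have "\<dots> = 0" using s2 True by simp
    finally show ?thesis by (rule order_trans) simp
  next
    case False
    then have s: "0 < s" using s0 by simp
    \<comment> \<open>This minimises
      \<open>t * s\<^sup>2 / 2 - t / (1 + t) * (s + u)\<^sup>2 / 2\<close>; the matching Chernoff
      parameter is \<open>r / 2\<close> with \<open>r = t / (1 + t)\<close>.\<close>
    define t where "t = u / s"
    have t: "0 < t" using s u by (simp add: t_def)
    define r where "r = u / (s + u)"
    have r: "0 < r" "t / (1 + t) = r" using s u by (simp_all add: t_def r_def field_simps)
    have int: "integrable M (\<lambda>\<omega>. exp (r / 2 * W \<omega>))"
      by (rule integrable_bounded[where C = "exp (r / 2 * C)"]) (use W(3) r in auto)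
    have "prob {\<omega> \<in> space M. W \<omega> \<ge> (s + u)\<^sup>2}
        \<le> exp (- (r / 2) * (s + u)\<^sup>2) * expectation (\<lambda>\<omega>. exp (r / 2 * W \<omega>))"
      using Chernoff_ineq_ge[of "r / 2" "space M" W "(s + u)\<^sup>2"] r int
      by (simp add: set_integrable_def set_integral_space integrable_mult_indicator flip: real_scaleR_def)
    also have "\<dots> \<le> exp (- (r / 2) * (s + u)\<^sup>2) * exp (t * s\<^sup>2 / 2)"
      using mgf[OF t] by (simp add: r(2) s2)
    also have "\<dots> = exp (- (r / 2) * (s + u)\<^sup>2 + t * s\<^sup>2 / 2)" by (rule exp_add[symmetric])
    also have "- (r / 2) * (s + u)\<^sup>2 + t * s\<^sup>2 / 2 = - (u\<^sup>2 / 2)"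
      using s u by (simp add: t_def r_def power2_eq_square field_simps)
    finally show ?thesis .
  qed
  finally show ?thesis by (simp add: s_def)
qed

end

theorem theorem10:
  fixes M :: "'a measure" and X :: "nat \<Rightarrow> 'a \<Rightarrow> real" and n :: nat and \<delta> :: real
  assumes "prob_space M"
    and "n \<ge> 2"
    and "prob_space.indep_vars M (\<lambda>_. borel) X {1..n}"
    and "\<And>i \<omega>. i \<in> {1..n} \<Longrightarrow> \<omega> \<in> space M \<Longrightarrow> X i \<omega> \<in> {0..1}"
    and "\<delta> > 0"
  shows "measure M {\<omega> \<in> space M.
            sqrt (prob_space.expectation M (\<lambda>\<omega>'. sample_variance n (\<lambda>i. X i \<omega>')))
              > sqrt (sample_variance n (\<lambda>i. X i \<omega>)) + sqrt (2 * ln (1 / \<delta>) / (real n - 1))} \<le> \<delta>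
       \<and> measure M {\<omega> \<in> space M.
            sqrt (sample_variance n (\<lambda>i. X i \<omega>))
              > sqrt (prob_space.expectation M (\<lambda>\<omega>'. sample_variance n (\<lambda>i. X i \<omega>')))
                + sqrt (2 * ln (1 / \<delta>) / (real n - 1))} \<le> \<delta>"
proof -
  interpret prob_space M by fact
  show ?thesis
  proof (cases "1 \<le> \<delta>")
    \<comment> \<open>The radicand may be negative here; the trivial bound of probabilities by
      \<open>1\<close> settles this case.\<close>
    case True
    then show ?thesis by (auto intro: order_trans[OF prob_le_1])
  next
    case False
    define W where "W \<omega> = weighted_square_dev {1..n} (\<lambda>_. 1) (\<lambda>i. X i \<omega>)" for \<omega>
    \<comment> \<open>The deviation is measured on the scale of \<open>W\<close>, that is
      \<open>n - 1\<close> times the sample variance, and chosen so that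
      \<open>exp (- (u\<^sup>2 / 2))\<close> equals \<open>\<delta>\<close>.\<close>
    define u where "u = sqrt (2 * ln (1 / \<delta>))"
    have "0 < ln (1 / \<delta>)" using False assms(5) by simp
    then have u: "0 < u" and u2: "exp (- (u\<^sup>2 / 2)) = \<delta>"
      using assms(5) by (simp_all add: u_def ln_div)
    have [measurable]: "random_variable borel (X i)" if "i \<in> {1..n}" for i
      using assms(3) that by (auto simp: indep_vars_def)
    have W0: "0 \<le> W \<omega>" for \<omega> by (simp add: W_def weighted_square_dev_nonneg)
    have Wn: "W \<omega> \<le> n" if "\<omega> \<in> space M" for \<omega>
      using weighted_square_dev_le_card[of "{1..n}" "\<lambda>_. 1" 1 "\<lambda>i. X i \<omega>"] assms(4)[OF _ that]
      by (simp add: W_def)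
    have [measurable]: "W \<in> borel_measurable M"
      unfolding W_def weighted_square_dev_def weighted_mean_def by measurable
    have int: "integrable M W"
      by (rule integrable_bounded[where C = n]) (use W0 Wn in auto)
    have "{1..n} \<noteq> {}" using assms(2) by simp
    note mgf = expectation_exp_square_dev[OF finite_atLeastAtMost this assms(3,4), folded W_def]
    have n1: "0 < real n - 1" using assms(2) by simp
    have V: "sample_variance n (\<lambda>i. X i \<omega>) = W \<omega> / (real n - 1)" for \<omega>
      using sample_variance_eq[OF assms(2)] by (simp add: W_def)
    \<comment> \<open>All three roots share the positive factor
      \<open>1 / sqrt (real n - 1)\<close>, which cancels.\<close>
    have scale: "sqrt (a / (real n - 1)) > sqrt (b / (real n - 1)) + sqrt (2 * ln (1 / \<delta>) / (real n - 1))
        \<longleftrightarrow> sqrt a > sqrt b + u" for a b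
      using n1 by (simp add: u_def real_sqrt_divide divide_less_cancel flip: add_divide_distrib)
    have "prob {\<omega> \<in> space M. sqrt (expectation W) > sqrt (W \<omega>) + u} \<le> exp (- (u\<^sup>2 / 2))"
      by (rule sqrt_lower_tail[OF int W0 u mgf(1)])
    moreover have "prob {\<omega> \<in> space M. sqrt (W \<omega>) > sqrt (expectation W) + u} \<le> exp (- (u\<^sup>2 / 2))"
      by (rule sqrt_upper_tail[OF int W0 Wn u mgf(2)])
    ultimately show ?thesis unfolding u2 V by (simp add: scale)
  qed
qed

end
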